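(* Let $G,H$ be graphs with no isolated vertices, and let $P_G$, $P_H$, $P_{G\times H}$ be pleats of $G$, $H$ and $G\times H$ respectively. Then $P_{G\times H}\cong P_G\times P_H$.
   Context: A graph is a finite undirected graph, loops allowed, at most one edge between two vertices; a graph morphism is a vertex map preserving edges. A vertex is isolated if it has no neighbors. $N(u)$ is the set of vertices adjacent to $u$ ($u\in N(u)$ iff $u$ is looped). The product $G\times H$ has vertex set $V(G)\times V(H)$ and $(v_1,w_1)\text{---}(v_2,w_2)$ iff $v_1\text{---}v_2$ in $G$ and $w_1\text{---}w_2$ in $H$. The exponential graph $H^G$ has as vertices the set maps $V(G)\to V(H)$, with $f\text{---}g$ iff $f(v_1)\text{---}g(v_2)$ for every edge $v_1\text{---}v_2$ of $G$. Morphisms are homotopic if joined by a sequence of morphisms consecutive ones adjacent in $H^G$; graphs $G,H$ are homotopy equivalent if there are morphisms $f:G\to H$, $g:H\to G$ with $gf$, $fg$ homotopic to the identities. A graph is stiff if there are no two distinct vertices $v,w$ with $N(v)\subseteq N(w)$. A pleat of $G$ is a stiff graph homotopy equivalent to $G$. *)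

theory Defs
  imports
    "HOL-Library.FuncSet"
    "Graph_Theory.Pair_Digraph"
    "Graph_Theory.Digraph_Isomorphism"
begin

text \<open>
  A finite undirected graph with loops allowed and no multiple edges is a
  \<^locale>\<open>pair_pseudo_graph\<close>: a finite vertex set with a symmetric set of pairs on it.
  Set maps between vertex sets are extensional functions, so that equality of vertices of an
  exponential graph is equality of maps on the vertex set.
\<close>

definition nbhd :: "'a pair_pre_digraph \<Rightarrow> 'a \<Rightarrow> 'a set" where
  "nbhd G u = {v. (u, v) \<in> parcs G}"

definition isolated :: "'a pair_pre_digraph \<Rightarrow> 'a \<Rightarrow> bool" where
  "isolated G u \<longleftrightarrow> u \<in> pverts G \<and> nbhd G u = {}"

definition graph_prod ::
    "'a pair_pre_digraph \<Rightarrow> 'b pair_pre_digraph \<Rightarrow> ('a \<times> 'b) pair_pre_digraph" where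
  "graph_prod G H =
    \<lparr> pverts = pverts G \<times> pverts H,
      parcs = {((v1, w1), (v2, w2)) | v1 w1 v2 w2. (v1, v2) \<in> parcs G \<and> (w1, w2) \<in> parcs H} \<rparr>"

text \<open>\<open>graph_exp H G\<close> is the exponential graph $H^G$ (base first).\<close>

definition graph_exp ::
    "'b pair_pre_digraph \<Rightarrow> 'a pair_pre_digraph \<Rightarrow> ('a \<Rightarrow> 'b) pair_pre_digraph" where
  "graph_exp H G =
    \<lparr> pverts = pverts G \<rightarrow>\<^sub>E pverts H,
      parcs = {(f, g). f \<in> pverts G \<rightarrow>\<^sub>E pverts H \<and> g \<in> pverts G \<rightarrow>\<^sub>E pverts H \<and>
                 (\<forall>v1 v2. (v1, v2) \<in> parcs G \<longrightarrow> (f v1, g v2) \<in> parcs H)} \<rparr>"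

definition graph_mor :: "'a pair_pre_digraph \<Rightarrow> 'b pair_pre_digraph \<Rightarrow> ('a \<Rightarrow> 'b) set" where
  "graph_mor G H =
    {f \<in> pverts G \<rightarrow>\<^sub>E pverts H. \<forall>v1 v2. (v1, v2) \<in> parcs G \<longrightarrow> (f v1, f v2) \<in> parcs H}"

definition homotopic ::
    "'a pair_pre_digraph \<Rightarrow> 'b pair_pre_digraph \<Rightarrow> ('a \<Rightarrow> 'b) \<Rightarrow> ('a \<Rightarrow> 'b) \<Rightarrow> bool" where
  "homotopic G H f g \<longleftrightarrow>
    f \<in> graph_mor G H \<and> g \<in> graph_mor G H \<and>
    (f, g) \<in> (parcs (graph_exp H G) \<inter> graph_mor G H \<times> graph_mor G H)\<^sup>*"

definition homotopy_equivalent :: "'a pair_pre_digraph \<Rightarrow> 'b pair_pre_digraph \<Rightarrow> bool" where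
  "homotopy_equivalent G H \<longleftrightarrow>
    (\<exists>f \<in> graph_mor G H. \<exists>g \<in> graph_mor H G.
       homotopic G G (compose (pverts G) g f) (\<lambda>v\<in>pverts G. v) \<and>
       homotopic H H (compose (pverts H) f g) (\<lambda>w\<in>pverts H. w))"

definition stiff :: "'a pair_pre_digraph \<Rightarrow> bool" where
  "stiff G \<longleftrightarrow>
    \<not> (\<exists>v \<in> pverts G. \<exists>w \<in> pverts G. v \<noteq> w \<and> nbhd G v \<subseteq> nbhd G w)"

definition pleat :: "'p pair_pre_digraph \<Rightarrow> 'a pair_pre_digraph \<Rightarrow> bool" where
  "pleat P G \<longleftrightarrow> pair_pseudo_graph P \<and> stiff P \<and> homotopy_equivalent P G"

definition graph_iso :: "'a pair_pre_digraph \<Rightarrow> 'b pair_pre_digraph \<Rightarrow> bool" where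
  "graph_iso G H \<longleftrightarrow> digraph_iso (with_proj G) (with_proj H)"

text \<open>
  For graphs represented by pairs, an isomorphism in the sense of
  \<^const>\<open>digraph_iso\<close> is a bijection on vertices preserving and reflecting adjacency.
\<close>

lemma graph_iso_iff:
  assumes "pair_wf_digraph G" and "pair_wf_digraph H"
  shows "graph_iso G H \<longleftrightarrow>
    (\<exists>f. bij_betw f (pverts G) (pverts H) \<and>
      (\<forall>u \<in> pverts G. \<forall>v \<in> pverts G. (u, v) \<in> parcs G \<longleftrightarrow> (f u, f v) \<in> parcs H))"
    (is "_ \<longleftrightarrow> (\<exists>f. ?iso f)")
proof
  interpret G: pair_wf_digraph G by fact
  interpret H: pair_wf_digraph H by fact
  assume "graph_iso G H"
  then obtain h where h: "pre_digraph.digraph_isomorphism (with_proj G) h"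
    and H: "with_proj H = app_iso h (with_proj G)"
    unfolding graph_iso_def digraph_iso_def by blast
  define f where "f = iso_verts h"
  have V: "pverts H = f ` pverts G" and A: "parcs H = iso_arcs h ` parcs G"
    and T: "iso_tail h = fst" and D: "iso_head h = snd"
    using arg_cong[OF H, of verts] arg_cong[OF H, of arcs]
      arg_cong[OF H, of tail] arg_cong[OF H, of head] by (simp_all add: f_def)
  have inj: "inj_on f (pverts G)"
    and ends: "\<And>a. a \<in> parcs G \<Longrightarrow> iso_arcs h a = (f (fst a), f (snd a))"
    using h by (auto simp: pre_digraph.digraph_isomorphism_def T D f_def prod_eq_iff)
  have A': "parcs H = (\<lambda>a. (f (fst a), f (snd a))) ` parcs G"
    using A ends by simp
  have "(u, v) \<in> parcs G \<longleftrightarrow> (f u, f v) \<in> parcs H"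
    if uv: "u \<in> pverts G" "v \<in> pverts G" for u v
  proof
    assume "(u, v) \<in> parcs G"
    then show "(f u, f v) \<in> parcs H" unfolding A' by (rule rev_image_eqI) simp
  next
    assume "(f u, f v) \<in> parcs H"
    then obtain x y where xy: "(x, y) \<in> parcs G" and eq: "f u = f x" "f v = f y"
      unfolding A' by auto
    have "u = x" "v = y"
      using eq uv G.in_arcsD1[OF xy] G.in_arcsD2[OF xy] inj by (auto dest: inj_onD)
    with xy show "(u, v) \<in> parcs G" by simp
  qed
  then have "?iso f"
    using V inj by (simp add: bij_betw_def)
  then show "\<exists>f. ?iso f" by blast
next
  interpret G: pair_wf_digraph G by fact
  interpret H: pair_wf_digraph H by fact
  assume "\<exists>f. ?iso f"
  then obtain f where inj: "inj_on f (pverts G)" and V: "pverts H = f ` pverts G"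
    and E: "\<And>u v. u \<in> pverts G \<Longrightarrow> v \<in> pverts G \<Longrightarrow>
      (u, v) \<in> parcs G \<longleftrightarrow> (f u, f v) \<in> parcs H"
    by (auto simp: bij_betw_def)
  define h where "h = \<lparr> iso_verts = f, iso_arcs = (\<lambda>a. (f (fst a), f (snd a))),
    iso_head = snd, iso_tail = fst \<rparr>"
  have "(x, y) \<in> (\<lambda>a. (f (fst a), f (snd a))) ` parcs G" if xy: "(x, y) \<in> parcs H" for x y
  proof -
    obtain u v where "u \<in> pverts G" "v \<in> pverts G" "x = f u" "y = f v"
      using H.in_arcsD1[OF xy] H.in_arcsD2[OF xy] V by auto
    then show ?thesis using E xy by force
  qed
  moreover have "(f u, f v) \<in> parcs H" if uv: "(u, v) \<in> parcs G" for u v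
    using E[OF G.in_arcsD1[OF uv] G.in_arcsD2[OF uv]] uv by simp
  ultimately have "parcs H = (\<lambda>a. (f (fst a), f (snd a))) ` parcs G"
    by auto
  then have "with_proj H = app_iso h (with_proj G)"
    using V by (simp add: app_iso_def h_def with_proj_def)
  moreover have "inj_on (\<lambda>a. (f (fst a), f (snd a))) (parcs G)"
  proof (rule inj_onI)
    fix a b assume "a \<in> parcs G" "b \<in> parcs G" "(f (fst a), f (snd a)) = (f (fst b), f (snd b))"
    then show "a = b"
      using inj by (auto simp: prod_eq_iff dest: inj_onD
          intro: G.arc_fst_in_verts G.arc_snd_in_verts)
  qed
  then have "pre_digraph.digraph_isomorphism (with_proj G) h"
    using inj G.wf_digraph by (simp add: pre_digraph.digraph_isomorphism_def h_def)
  ultimately show "graph_iso G H"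
    unfolding graph_iso_def digraph_iso_def by blast
qed

lemma pair_pseudo_graph_prod:
  assumes "pair_pseudo_graph G" and "pair_pseudo_graph H"
  shows "pair_pseudo_graph (graph_prod G H)"
proof -
  interpret G: pair_pseudo_graph G by fact
  interpret H: pair_pseudo_graph H by fact
  have sub: "parcs (graph_prod G H) \<subseteq> (pverts G \<times> pverts H) \<times> (pverts G \<times> pverts H)"
    by (auto simp: graph_prod_def dest: G.in_arcsD1 G.in_arcsD2 H.in_arcsD1 H.in_arcsD2)
  have "sym (parcs G)" "sym (parcs H)"
    using G.pair_sym_arcs H.pair_sym_arcs by (simp_all add: symmetric_def)
  then have "sym (parcs (graph_prod G H))"
    by (auto simp: graph_prod_def sym_def)
  moreover have "finite (parcs (graph_prod G H))"
    using sub by (rule finite_subset) (simp add: G.pair_finite_verts H.pair_finite_verts)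
  ultimately show ?thesis
    using sub by unfold_locales
      (auto simp: symmetric_def graph_prod_def G.pair_finite_verts H.pair_finite_verts
        dest: G.in_arcsD1 G.in_arcsD2 H.in_arcsD1 H.in_arcsD2)
qed

lemma pair_pseudo_graph_exp:
  assumes "pair_pseudo_graph G" and "pair_pseudo_graph H"
  shows "pair_pseudo_graph (graph_exp H G)"
proof -
  interpret G: pair_pseudo_graph G by fact
  interpret H: pair_pseudo_graph H by fact
  let ?F = "pverts G \<rightarrow>\<^sub>E pverts H"
  have sub: "parcs (graph_exp H G) \<subseteq> ?F \<times> ?F"
    by (auto simp: graph_exp_def)
  have fin: "finite ?F"
    by (simp add: finite_PiE G.pair_finite_verts H.pair_finite_verts)
  have "sym (parcs G)" "sym (parcs H)"
    using G.pair_sym_arcs H.pair_sym_arcs by (simp_all add: symmetric_def)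
  then have "sym (parcs (graph_exp H G))"
    by (intro symI) (simp add: graph_exp_def, meson symD)
  moreover have "finite (parcs (graph_exp H G))"
    using sub by (rule finite_subset) (simp add: fin)
  ultimately show ?thesis
    using sub fin by unfold_locales (auto simp: symmetric_def graph_exp_def)
qed

end

theory Submission
  imports Defs
begin

text \<open>
  A self-map \<open>f\<close> adjacent to the identity satisfies $N(v) \subseteq N(f(v))$, so on a stiff graph
  only the identity is homotopic to the identity; hence homotopy equivalent stiff graphs are
  isomorphic. Homotopy equivalence is compatible with products because morphisms are looped in the
  exponential graph, which lets one factor move at a time. Finally $N(v,w) = N(v) \times N(w)$, so
  a product of stiff graphs is stiff as long as all neighbourhoods are nonempty.
\<close>

section \<open>Graph morphisms and homotopies between them\<close>

lemma graph_morI: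
  assumes "\<And>v. v \<in> pverts G \<Longrightarrow> f v \<in> pverts H" and "\<And>v. v \<notin> pverts G \<Longrightarrow> f v = undefined"
    and "\<And>v w. (v, w) \<in> parcs G \<Longrightarrow> (f v, f w) \<in> parcs H"
  shows "f \<in> graph_mor G H"
  using assms by (auto simp: graph_mor_def)

lemma graph_mor_PiE: "f \<in> graph_mor G H \<Longrightarrow> f \<in> pverts G \<rightarrow>\<^sub>E pverts H"
  by (simp add: graph_mor_def)

lemma graph_mor_vert: "f \<in> graph_mor G H \<Longrightarrow> v \<in> pverts G \<Longrightarrow> f v \<in> pverts H"
  by (auto simp: graph_mor_def)

lemma graph_mor_arc: "f \<in> graph_mor G H \<Longrightarrow> (v, w) \<in> parcs G \<Longrightarrow> (f v, f w) \<in> parcs H"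
  by (auto simp: graph_mor_def)

lemma parcs_graph_exp_mor_iff:
  assumes "f \<in> graph_mor G H" and "g \<in> graph_mor G H"
  shows "(f, g) \<in> parcs (graph_exp H G) \<longleftrightarrow>
    (\<forall>v w. (v, w) \<in> parcs G \<longrightarrow> (f v, g w) \<in> parcs H)"
  using assms by (simp add: graph_exp_def graph_mor_def)

lemma graph_mor_compose:
  assumes "pair_wf_digraph G" and "f \<in> graph_mor G H" and "g \<in> graph_mor H K"
  shows "compose (pverts G) g f \<in> graph_mor G K"
proof -
  interpret pair_wf_digraph G by fact
  show ?thesis
    using assms(2,3) by (intro graph_morI)
      (auto simp: compose_def dest: in_arcsD1 in_arcsD2 intro: graph_mor_vert graph_mor_arc)
qed

lemma homotopic_trans:
  "homotopic G H f g \<Longrightarrow> homotopic G H g h \<Longrightarrow> homotopic G H f h"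
  by (auto simp: homotopic_def)

text \<open>Induction along the chain of morphisms: an operation \<open>F\<close> on morphisms that
  respects adjacency carries a chain to a chain. Adjacency is unfolded to edges in
  \<open>adj\<close>, so that pre- and postcomposition and the product with a fixed morphism can all
  be checked edge by edge.\<close>

lemma homotopic_map:
  assumes hom: "homotopic G H f g"
    and mor: "\<And>f. f \<in> graph_mor G H \<Longrightarrow> F f \<in> graph_mor K L"
    and adj: "\<And>f g v w. f \<in> graph_mor G H \<Longrightarrow> g \<in> graph_mor G H \<Longrightarrow>
      (\<And>v w. (v, w) \<in> parcs G \<Longrightarrow> (f v, g w) \<in> parcs H) \<Longrightarrow> (v, w) \<in> parcs K \<Longrightarrow>
      (F f v, F g w) \<in> parcs L"
  shows "homotopic K L (F f) (F g)"
proof -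
  have "(F f, F g) \<in> (parcs (graph_exp L K) \<inter> graph_mor K L \<times> graph_mor K L)\<^sup>*"
    if "(f, g) \<in> (parcs (graph_exp H G) \<inter> graph_mor G H \<times> graph_mor G H)\<^sup>*"
    using that
  proof induction
    case base
    show ?case by simp
  next
    case (step g h)
    then have g: "g \<in> graph_mor G H" and h: "h \<in> graph_mor G H"
      and gh: "\<And>v w. (v, w) \<in> parcs G \<Longrightarrow> (g v, h w) \<in> parcs H"
      by (auto simp: parcs_graph_exp_mor_iff)
    have "(F g, F h) \<in> parcs (graph_exp L K) \<inter> graph_mor K L \<times> graph_mor K L"
      using mor[OF g] mor[OF h] adj[OF g h gh] by (simp add: parcs_graph_exp_mor_iff)
    with step.IH show ?case by (rule rtrancl_into_rtrancl)
  qed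
  then show ?thesis using hom mor by (simp add: homotopic_def)
qed

text \<open>Whiskering on both sides: \<open>f\<close> sends an edge of \<open>A\<close> to an edge
  of \<open>G\<close>, an adjacent pair \<open>p\<close>, \<open>q\<close> sends that to an edge of
  \<open>H\<close>, and \<open>k\<close> sends this to an edge of \<open>B\<close>.\<close>

lemma homotopic_compose_compose:
  assumes A: "pair_wf_digraph A" and f: "f \<in> graph_mor A G"
    and k: "k \<in> graph_mor H B" and hom: "homotopic G H p q"
  shows "homotopic A B (compose (pverts A) k (compose (pverts A) p f))
    (compose (pverts A) k (compose (pverts A) q f))"
  using hom
proof (rule homotopic_map)
  fix p assume "p \<in> graph_mor G H"
  then show "compose (pverts A) k (compose (pverts A) p f) \<in> graph_mor A B"
    using A f k by (intro graph_mor_compose[of A]) auto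
next
  interpret pair_wf_digraph A by fact
  fix p q v w
  assume "\<And>v w. (v, w) \<in> parcs G \<Longrightarrow> (p v, q w) \<in> parcs H" and vw: "(v, w) \<in> parcs A"
  then have "(k (p (f v)), k (q (f w))) \<in> parcs B"
    using graph_mor_arc[OF f] graph_mor_arc[OF k] by blast
  then show "(compose (pverts A) k (compose (pverts A) p f) v,
      compose (pverts A) k (compose (pverts A) q f) w) \<in> parcs B"
    using in_arcsD1[OF vw] in_arcsD2[OF vw] by (simp add: compose_def)
qed

section \<open>Symmetry and transitivity of homotopy equivalence\<close>

text \<open>The inner round trip \<open>k h\<close> is contracted first, between \<open>f\<close>
  and \<open>g\<close>, and then \<open>g f\<close> is contracted. This is one half of transitivity;
  the other half is the same statement started at \<open>C\<close>, with the two pairs of morphisms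
  exchanged.\<close>

lemma homotopic_id_trans:
  assumes A: "pair_wf_digraph A"
    and f: "f \<in> graph_mor A B" and g: "g \<in> graph_mor B A"
    and h: "h \<in> graph_mor B C" and k: "k \<in> graph_mor C B"
    and gf: "homotopic A A (compose (pverts A) g f) (\<lambda>v\<in>pverts A. v)"
    and kh: "homotopic B B (compose (pverts B) k h) (\<lambda>v\<in>pverts B. v)"
  shows "homotopic A A
    (compose (pverts A) (compose (pverts C) g k) (compose (pverts A) h f)) (\<lambda>v\<in>pverts A. v)"
proof -
  \<comment> \<open>Regrouping is an equality of functions because \<open>f\<close> and
    \<open>h\<close> land in the vertex sets to which the inner compositions are restricted.\<close>
  have "compose (pverts A) (compose (pverts C) g k) (compose (pverts A) h f) =
      compose (pverts A) g (compose (pverts A) (compose (pverts B) k h) f)"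
    using graph_mor_vert[OF f] graph_mor_vert[OF h] by (auto simp: compose_def)
  moreover have "compose (pverts A) g f =
      compose (pverts A) g (compose (pverts A) (\<lambda>v\<in>pverts B. v) f)"
    using graph_mor_vert[OF f] by (auto simp: compose_def)
  ultimately show ?thesis
    using homotopic_compose_compose[OF A f g kh] gf by (metis homotopic_trans)
qed

lemma homotopy_equivalent_sym: "homotopy_equivalent G H \<Longrightarrow> homotopy_equivalent H G"
  unfolding homotopy_equivalent_def by blast

lemma homotopy_equivalent_trans:
  assumes "pair_wf_digraph A" and "pair_wf_digraph C"
    and "homotopy_equivalent A B" and "homotopy_equivalent B C"
  shows "homotopy_equivalent A C"
proof -
  obtain f g where fg: "f \<in> graph_mor A B" "g \<in> graph_mor B A"
    "homotopic A A (compose (pverts A) g f) (\<lambda>v\<in>pverts A. v)"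
    "homotopic B B (compose (pverts B) f g) (\<lambda>v\<in>pverts B. v)"
    using assms(3) unfolding homotopy_equivalent_def by blast
  obtain h k where hk: "h \<in> graph_mor B C" "k \<in> graph_mor C B"
    "homotopic B B (compose (pverts B) k h) (\<lambda>v\<in>pverts B. v)"
    "homotopic C C (compose (pverts C) h k) (\<lambda>v\<in>pverts C. v)"
    using assms(4) unfolding homotopy_equivalent_def by blast
  show ?thesis unfolding homotopy_equivalent_def
    using homotopic_id_trans[OF assms(1) fg(1,2) hk(1,2) fg(3) hk(3)]
      homotopic_id_trans[OF assms(2) hk(2,1) fg(2,1) hk(4) fg(4)]
      graph_mor_compose[OF assms(1) fg(1) hk(1)] graph_mor_compose[OF assms(2) hk(2) fg(2)]
    by blast
qed

section \<open>Products of morphisms and of homotopies\<close>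

text \<open>The restriction makes the map extensional, as membership in \<open>graph_mor\<close>
  demands.\<close>

definition mor_prod ::
    "'a pair_pre_digraph \<Rightarrow> 'b pair_pre_digraph \<Rightarrow> ('a \<Rightarrow> 'c) \<Rightarrow> ('b \<Rightarrow> 'd) \<Rightarrow> 'a \<times> 'b \<Rightarrow> 'c \<times> 'd" where
  "mor_prod G H f h = (\<lambda>x\<in>pverts G \<times> pverts H. map_prod f h x)"

lemma pverts_graph_prod [simp]: "pverts (graph_prod G H) = pverts G \<times> pverts H"
  by (simp add: graph_prod_def)

lemma parcs_graph_prod [simp]:
  "((v, w), (v', w')) \<in> parcs (graph_prod G H) \<longleftrightarrow> (v, v') \<in> parcs G \<and> (w, w') \<in> parcs H"
  by (simp add: graph_prod_def)

lemma mor_prod_apply [simp]: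
  "v \<in> pverts G \<Longrightarrow> w \<in> pverts H \<Longrightarrow> mor_prod G H f h (v, w) = (f v, h w)"
  by (simp add: mor_prod_def)

text \<open>Stated for two maps in each factor to serve twice: with \<open>f = f'\<close> and
  \<open>h = h'\<close> it shows that a product of morphisms is a morphism, and with equality in
  only one factor it gives the steps of a homotopy that moves the other.\<close>

lemma mor_prod_adjacent:
  assumes "pair_wf_digraph G" and "pair_wf_digraph H"
    and "\<And>v w. (v, w) \<in> parcs G \<Longrightarrow> (f v, f' w) \<in> parcs G'"
    and "\<And>v w. (v, w) \<in> parcs H \<Longrightarrow> (h v, h' w) \<in> parcs H'"
    and "(x, y) \<in> parcs (graph_prod G H)"
  shows "(mor_prod G H f h x, mor_prod G H f' h' y) \<in> parcs (graph_prod G' H')"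
proof -
  interpret G: pair_wf_digraph G by fact
  interpret H: pair_wf_digraph H by fact
  obtain v w v' w' where xy: "x = (v, w)" "y = (v', w')" by fastforce
  then have vv': "(v, v') \<in> parcs G" and ww': "(w, w') \<in> parcs H" using assms(5) by simp_all
  show ?thesis
    using assms(3)[OF vv'] assms(4)[OF ww'] G.in_arcsD1[OF vv'] G.in_arcsD2[OF vv']
      H.in_arcsD1[OF ww'] H.in_arcsD2[OF ww'] by (simp add: xy)
qed

lemma mor_prod_mor:
  assumes "pair_wf_digraph G" and "pair_wf_digraph H"
    and "f \<in> graph_mor G G'" and "h \<in> graph_mor H H'"
  shows "mor_prod G H f h \<in> graph_mor (graph_prod G H) (graph_prod G' H')"
proof (rule graph_morI)
  fix x y assume "(x, y) \<in> parcs (graph_prod G H)"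
  then show "(mor_prod G H f h x, mor_prod G H f h y) \<in> parcs (graph_prod G' H')"
    using assms(1,2) graph_mor_arc[OF assms(3)] graph_mor_arc[OF assms(4)]
    by (intro mor_prod_adjacent)
qed (use assms(3,4) in \<open>auto simp: mor_prod_def graph_mor_vert\<close>)

text \<open>The two given chains may differ in length, so they are run one after the other: from
  \<open>f\<close> to \<open>f'\<close> with \<open>h\<close> fixed, then from \<open>h\<close> to
  \<open>h'\<close> with \<open>f'\<close> fixed.\<close>

lemma homotopic_mor_prod:
  assumes wf: "pair_wf_digraph G" "pair_wf_digraph H"
    and f: "homotopic G G' f f'" and h: "homotopic H H' h h'"
  shows "homotopic (graph_prod G H) (graph_prod G' H') (mor_prod G H f h) (mor_prod G H f' h')"
proof -
  have h_mor: "h \<in> graph_mor H H'" and f'_mor: "f' \<in> graph_mor G G'"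
    using f h by (auto simp: homotopic_def)
  have "homotopic (graph_prod G H) (graph_prod G' H') (mor_prod G H f h) (mor_prod G H f' h)"
  proof (rule homotopic_map[OF f, where F = "\<lambda>f. mor_prod G H f h"])
    fix p assume "p \<in> graph_mor G G'"
    then show "mor_prod G H p h \<in> graph_mor (graph_prod G H) (graph_prod G' H')"
      by (rule mor_prod_mor[OF wf _ h_mor])
  next
    fix p q x y
    assume "\<And>v w. (v, w) \<in> parcs G \<Longrightarrow> (p v, q w) \<in> parcs G'"
      and "(x, y) \<in> parcs (graph_prod G H)"
    then show "(mor_prod G H p h x, mor_prod G H q h y) \<in> parcs (graph_prod G' H')"
      using wf graph_mor_arc[OF h_mor] by (intro mor_prod_adjacent)
  qed
  moreover
  have "homotopic (graph_prod G H) (graph_prod G' H') (mor_prod G H f' h) (mor_prod G H f' h')"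
  proof (rule homotopic_map[OF h, where F = "mor_prod G H f'"])
    fix p assume "p \<in> graph_mor H H'"
    then show "mor_prod G H f' p \<in> graph_mor (graph_prod G H) (graph_prod G' H')"
      by (rule mor_prod_mor[OF wf f'_mor])
  next
    fix p q x y
    assume "\<And>v w. (v, w) \<in> parcs H \<Longrightarrow> (p v, q w) \<in> parcs H'"
      and "(x, y) \<in> parcs (graph_prod G H)"
    then show "(mor_prod G H f' p x, mor_prod G H f' q y) \<in> parcs (graph_prod G' H')"
      using wf graph_mor_arc[OF f'_mor] by (intro mor_prod_adjacent)
  qed
  ultimately show ?thesis by (rule homotopic_trans)
qed

text \<open>Composites and identities on a product are computed factor by factor, so the two given
  homotopies multiply. Exchanging the primed and unprimed graphs gives the other half of the
  equivalence of products.\<close>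

lemma homotopic_id_mor_prod:
  assumes wf: "pair_wf_digraph G" "pair_wf_digraph H"
    and f: "f \<in> graph_mor G G'" and h: "h \<in> graph_mor H H'"
    and gf: "homotopic G G (compose (pverts G) g f) (\<lambda>v\<in>pverts G. v)"
    and kh: "homotopic H H (compose (pverts H) k h) (\<lambda>v\<in>pverts H. v)"
  shows "homotopic (graph_prod G H) (graph_prod G H)
    (compose (pverts (graph_prod G H)) (mor_prod G' H' g k) (mor_prod G H f h))
    (\<lambda>x\<in>pverts (graph_prod G H). x)"
proof -
  have "compose (pverts (graph_prod G H)) (mor_prod G' H' g k) (mor_prod G H f h) =
      mor_prod G H (compose (pverts G) g f) (compose (pverts H) k h)"
    using graph_mor_vert[OF f] graph_mor_vert[OF h]
    by (auto simp: compose_def mor_prod_def restrict_def)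
  moreover have "(\<lambda>x\<in>pverts (graph_prod G H). x) =
      mor_prod G H (\<lambda>v\<in>pverts G. v) (\<lambda>v\<in>pverts H. v)"
    by (auto simp: mor_prod_def restrict_def)
  ultimately show ?thesis using homotopic_mor_prod[OF wf gf kh] by simp
qed

lemma homotopy_equivalent_graph_prod:
  assumes wf: "pair_wf_digraph G" "pair_wf_digraph H" "pair_wf_digraph G'" "pair_wf_digraph H'"
    and "homotopy_equivalent G G'" and "homotopy_equivalent H H'"
  shows "homotopy_equivalent (graph_prod G H) (graph_prod G' H')"
proof -
  obtain f g where fg: "f \<in> graph_mor G G'" "g \<in> graph_mor G' G"
    "homotopic G G (compose (pverts G) g f) (\<lambda>v\<in>pverts G. v)"
    "homotopic G' G' (compose (pverts G') f g) (\<lambda>v\<in>pverts G'. v)"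
    using assms(5) unfolding homotopy_equivalent_def by blast
  obtain h k where hk: "h \<in> graph_mor H H'" "k \<in> graph_mor H' H"
    "homotopic H H (compose (pverts H) k h) (\<lambda>v\<in>pverts H. v)"
    "homotopic H' H' (compose (pverts H') h k) (\<lambda>v\<in>pverts H'. v)"
    using assms(6) unfolding homotopy_equivalent_def by blast
  show ?thesis unfolding homotopy_equivalent_def
    using homotopic_id_mor_prod[OF wf(1,2) fg(1) hk(1) fg(3) hk(3)]
      homotopic_id_mor_prod[OF wf(3,4) fg(2) hk(2) fg(4) hk(4)]
      mor_prod_mor[OF wf(1,2) fg(1) hk(1)] mor_prod_mor[OF wf(3,4) fg(2) hk(2)]
    by blast
qed

section \<open>Rigidity of stiff graphs\<close>

lemma stiff_homotopic_id:
  assumes "pair_pseudo_graph P" and "stiff P" and "homotopic P P f (\<lambda>v\<in>pverts P. v)"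
  shows "f = (\<lambda>v\<in>pverts P. v)"
proof -
  interpret pair_pseudo_graph P by fact
  let ?M = "graph_mor P P"
  have "(f, \<lambda>v\<in>pverts P. v) \<in> (parcs (graph_exp P P) \<inter> ?M \<times> ?M)\<^sup>*"
    using assms(3) by (simp add: homotopic_def)
  then show ?thesis
  \<comment> \<open>The induction starts at the identity end of the chain, so in each step the
    successor \<open>g\<close> of \<open>f\<close> is already known to be the identity.\<close>
  proof (induction rule: converse_rtrancl_induct)
    case base
    show ?case by simp
  next
    case (step f g)
    then have f: "f \<in> ?M" and fg: "(f, g) \<in> parcs (graph_exp P P)" by simp_all
    have adj: "(f v, w) \<in> parcs P" if vw: "(v, w) \<in> parcs P" for v w
    proof -
      have "(f v, g w) \<in> parcs P" using fg vw unfolding graph_exp_def by simp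
      then show ?thesis using in_arcsD2[OF vw] step.IH by simp
    qed
    have "f v = v" if v: "v \<in> pverts P" for v
    proof -
      have "nbhd P v \<subseteq> nbhd P (f v)" using adj by (auto simp: nbhd_def)
      then show ?thesis
        using \<open>stiff P\<close> v graph_mor_vert[OF f v] unfolding stiff_def by metis
    qed
    then show ?case using graph_mor_PiE[OF f] by (auto simp: PiE_def extensional_def)
  qed
qed

text \<open>By rigidity both round trips equal the identity, so \<open>f\<close> and
  \<open>g\<close> are mutually inverse morphisms; \<open>f\<close> reflects adjacency because
  \<open>g\<close> preserves it.\<close>

lemma stiff_homotopy_equivalent_iso:
  assumes P: "pair_pseudo_graph P" "stiff P" and Q: "pair_pseudo_graph Q" "stiff Q"
    and eq: "homotopy_equivalent P Q"
  shows "graph_iso P Q"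
proof -
  interpret P: pair_pseudo_graph P by fact
  interpret Q: pair_pseudo_graph Q by fact
  obtain f g where f: "f \<in> graph_mor P Q" and g: "g \<in> graph_mor Q P"
    and "homotopic P P (compose (pverts P) g f) (\<lambda>v\<in>pverts P. v)"
    and "homotopic Q Q (compose (pverts Q) f g) (\<lambda>v\<in>pverts Q. v)"
    using eq unfolding homotopy_equivalent_def by blast
  then have PP: "compose (pverts P) g f = (\<lambda>v\<in>pverts P. v)"
    and QQ: "compose (pverts Q) f g = (\<lambda>v\<in>pverts Q. v)"
    by (auto intro: stiff_homotopic_id P Q)
  have gf: "g (f v) = v" if "v \<in> pverts P" for v
    using fun_cong[OF PP, of v] that by (simp add: compose_def)
  have fg: "f (g w) = w" if "w \<in> pverts Q" for w
    using fun_cong[OF QQ, of w] that by (simp add: compose_def)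
  have "bij_betw f (pverts P) (pverts Q)"
    by (rule bij_betw_byWitness[where f' = g])
      (use gf fg graph_mor_vert[OF f] graph_mor_vert[OF g] in auto)
  moreover have "(u, v) \<in> parcs P \<longleftrightarrow> (f u, f v) \<in> parcs Q"
    if "u \<in> pverts P" "v \<in> pverts P" for u v
    using that gf graph_mor_arc[OF f, of u v] graph_mor_arc[OF g, of "f u" "f v"] by auto
  ultimately show ?thesis
    unfolding graph_iso_iff[OF P.pair_wf_digraph_axioms Q.pair_wf_digraph_axioms]
    by (intro exI[of _ f] conjI ballI)
qed

section \<open>Isolated vertices, and stiffness of products\<close>

text \<open>An empty neighbourhood lies in every other one, so in a stiff graph an isolated
  \<open>p\<close> would be the only vertex. But \<open>f p\<close> has a neighbour in
  \<open>G\<close>, and \<open>g\<close> turns that edge into one at \<open>g (f p)\<close>, which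
  is therefore a vertex other than \<open>p\<close>.\<close>

lemma pleat_no_isolated:
  assumes G: "\<not> (\<exists>v. isolated G v)" and P: "pleat P G"
  shows "\<not> isolated P p"
proof
  interpret pair_pseudo_graph P using P by (simp add: pleat_def)
  assume "isolated P p"
  then have p: "p \<in> pverts P" and N: "nbhd P p = {}" by (auto simp: isolated_def)
  obtain f g where f: "f \<in> graph_mor P G" and g: "g \<in> graph_mor G P"
    using P unfolding pleat_def homotopy_equivalent_def by blast
  obtain w where "(f p, w) \<in> parcs G"
    using G graph_mor_vert[OF f p] by (auto simp: isolated_def nbhd_def)
  from graph_mor_arc[OF g this] have gw: "(g (f p), g w) \<in> parcs P" .
  then have "p \<noteq> g (f p)" using N by (auto simp: nbhd_def)
  moreover have "nbhd P p \<subseteq> nbhd P (g (f p))" using N by simp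
  moreover have "stiff P" using P by (simp add: pleat_def)
  ultimately show False using p in_arcsD1[OF gw] unfolding stiff_def by metis
qed

lemma stiff_graph_prod:
  assumes "stiff G" and "stiff H" and G: "\<And>v. \<not> isolated G v" and H: "\<And>w. \<not> isolated H w"
  shows "stiff (graph_prod G H)"
proof -
  have nbhd: "nbhd (graph_prod G H) (v, w) = nbhd G v \<times> nbhd H w" for v w
    by (auto simp: nbhd_def)
  have "v = v' \<and> w = w'"
    if "v \<in> pverts G" "w \<in> pverts H" "v' \<in> pverts G" "w' \<in> pverts H"
      "nbhd G v \<times> nbhd H w \<subseteq> nbhd G v' \<times> nbhd H w'" for v w v' w'
  proof -
    \<comment> \<open>An inclusion of products passes to the factors only when the smaller product
      is nonempty.\<close>
    have "nbhd G v \<noteq> {}" "nbhd H w \<noteq> {}"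
      using that G H by (auto simp: isolated_def)
    then have "nbhd G v \<subseteq> nbhd G v'" "nbhd H w \<subseteq> nbhd H w'"
      using that by (auto simp: times_subset_iff)
    with that(1-4) assms(1,2) show ?thesis unfolding stiff_def by metis
  qed
  then show ?thesis unfolding stiff_def by (auto simp: nbhd)
qed

theorem theorem5p7:
  fixes G :: "'a pair_pre_digraph" and H :: "'b pair_pre_digraph"
    and PG :: "'c pair_pre_digraph" and PH :: "'d pair_pre_digraph"
    and PGH :: "'e pair_pre_digraph"
  assumes "pair_pseudo_graph G" and "pair_pseudo_graph H"
    and "\<not> (\<exists>v. isolated G v)" and "\<not> (\<exists>w. isolated H w)"
    and "pleat PG G" and "pleat PH H" and "pleat PGH (graph_prod G H)"
  shows "graph_iso PGH (graph_prod PG PH)"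
proof -
  have ps: "pair_pseudo_graph PG" "pair_pseudo_graph PH" "pair_pseudo_graph PGH"
    using assms(5-7) by (simp_all add: pleat_def)
  \<comment> \<open>Descends the locale hierarchy from \<open>pair_pseudo_graph\<close> through
    \<open>pair_fin_digraph\<close> to \<open>pair_wf_digraph\<close>.\<close>
  note wf = pair_fin_digraph.axioms(1)[OF pair_pseudo_graph.axioms(1)]
  have stiff: "stiff (graph_prod PG PH)"
    using assms(5,6) pleat_no_isolated[OF assms(3,5)] pleat_no_isolated[OF assms(4,6)]
    by (intro stiff_graph_prod) (simp_all add: pleat_def)
  have prod: "pair_pseudo_graph (graph_prod PG PH)"
    using ps(1,2) by (rule pair_pseudo_graph_prod)
  have "homotopy_equivalent (graph_prod PG PH) (graph_prod G H)"
    using homotopy_equivalent_graph_prod[OF wf[OF ps(1)] wf[OF ps(2)] wf[OF assms(1)] wf[OF assms(2)]]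
      assms(5,6) by (simp add: pleat_def)
  \<comment> \<open>The two stiff graphs are linked through \<open>graph_prod G H\<close>, with the
    equivalence just proved reversed.\<close>
  then have "homotopy_equivalent PGH (graph_prod PG PH)"
    using homotopy_equivalent_trans[OF wf[OF ps(3)] wf[OF prod], where B = "graph_prod G H"] assms(7)
    by (simp add: pleat_def homotopy_equivalent_sym)
  then show ?thesis
    using stiff_homotopy_equivalent_iso[OF ps(3) _ prod stiff] assms(7) by (simp add: pleat_def)
qed

end
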